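(* For every $\tau\in\mathbb{H}^2$, $$\theta'[\tfrac13,0]=-\frac13\,\frac{\theta'[1,1]\,\theta^3[\frac13,1]}{\theta^2[\frac13,0]\,\theta[1,0]},\qquad \theta'[\tfrac13,\tfrac23]=-\frac13\,\frac{\theta'[1,1]\,\theta^3[\frac13,\frac53]}{\theta^2[\frac13,\frac23]\,\theta[1,0]},\qquad\text{and}\qquad \theta'[\tfrac13,\tfrac43]=\frac13\,\frac{\theta'[1,1]\,\theta^3[\frac13,\frac13]}{\theta^2[\frac13,\frac43]\,\theta[1,0]}.$$
   Context: $\mathbb{H}^2=\{\tau\in\mathbb{C} : \Im\tau>0\}$ is the upper half plane. For $\epsilon,\epsilon'\in\mathbb{R}$, $\zeta\in\mathbb{C}$, $\tau\in\mathbb{H}^2$, the theta function with characteristics is $$\theta[\epsilon,\epsilon'](\zeta,\tau)=\sum_{n\in\mathbb{Z}}\exp\left(2\pi i\left[\tfrac12\left(n+\tfrac{\epsilon}{2}\right)^2\tau+\left(n+\tfrac{\epsilon}{2}\right)\left(\zeta+\tfrac{\epsilon'}{2}\right)\right]\right).$$ Write $\theta[\epsilon,\epsilon']=\theta[\epsilon,\epsilon'](0,\tau)$ and $\theta'[\epsilon,\epsilon']=\frac{\partial}{\partial\zeta}\theta[\epsilon,\epsilon'](\zeta,\tau)\big|_{\zeta=0}$; $\theta^k[\epsilon,\epsilon']$ means the $k$-th power of $\theta[\epsilon,\epsilon']$. *)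

theory Defs
  imports "HOL-Analysis.Analysis"
begin

text \<open>
  The theta function with real characteristics. For \<open>Im \<tau> > 0\<close> the series converges
  absolutely for every \<open>\<zeta>\<close>, so the unordered sum over all integers is its value.
\<close>

definition theta :: "real \<Rightarrow> real \<Rightarrow> complex \<Rightarrow> complex \<Rightarrow> complex" where
  "theta \<epsilon> \<epsilon>' \<zeta> \<tau> =
     (\<Sum>\<^sub>\<infinity>n::int. exp (2 * of_real pi * \<i> *
        (1 / 2 * (of_int n + of_real \<epsilon> / 2)\<^sup>2 * \<tau> +
         (of_int n + of_real \<epsilon> / 2) * (\<zeta> + of_real \<epsilon>' / 2))))"

definition theta_const :: "real \<Rightarrow> real \<Rightarrow> complex \<Rightarrow> complex" where
  "theta_const \<epsilon> \<epsilon>' \<tau> = theta \<epsilon> \<epsilon>' 0 \<tau>"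

definition theta_deriv :: "real \<Rightarrow> real \<Rightarrow> complex \<Rightarrow> complex" where
  "theta_deriv \<epsilon> \<epsilon>' \<tau> = deriv (\<lambda>\<zeta>. theta \<epsilon> \<epsilon>' \<zeta> \<tau>) 0"

end

theory Submission
  imports Defs "HOL-Complex_Analysis.Complex_Analysis"
begin

text \<open>
  Fix \<open>\<epsilon>'\<close> with \<open>3 \<epsilon>'\<close> an even integer, write \<open>\<phi> \<zeta> = \<theta>[1/3, \<epsilon>'](\<zeta>)\<close>, and let \<open>F = \<phi>\<^sup>3\<close>. Cubing turns
  the characteristic \<open>1/3\<close> into \<open>1\<close>, so that \<open>F\<close> is an entire function with the
  multipliers \<open>F (\<zeta> + 1) = - F \<zeta>\<close> and \<open>F (\<zeta> + \<tau>) = exp (- 3 \<pi> \<i> (\<tau> + 2 \<zeta>)) F \<zeta>\<close>. Since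
  \<open>F (- \<zeta>)\<close> obeys the same two laws, so does the odd function \<open>G \<zeta> = F \<zeta> - F (- \<zeta>)\<close>. Oddness and
  the quasi-periods force \<open>G\<close> to vanish at the half periods \<open>0\<close>, \<open>\<tau>/2\<close> and \<open>(1 + \<tau>)/2\<close>. These are,
  modulo the lattice \<open>\<int> + \<int> \<tau>\<close>, exactly the zeros of \<open>S = \<theta>[1,1] \<theta>[0,0] \<theta>[0,1]\<close>; they are
  simple, and \<open>S\<close> has the same multipliers as \<open>G\<close>. Hence \<open>G / S\<close> is entire and doubly periodic, and
  \<open>G = c S\<close> by Liouville's theorem.

  The constant drops out on comparing the two functions at two places. The derivative at \<open>0\<close> gives
  \<open>2 F' 0 = c \<theta>'[1,1] \<theta>[0,0] \<theta>[0,1]\<close>, and the value at \<open>1/2\<close>, where the shift permutes the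
  characteristics, gives \<open>2 F (1/2) = - c \<theta>[1,0] \<theta>[0,1] \<theta>[0,0]\<close>. Therefore
  \<open>F' 0 \<theta>[1,0] = - \<theta>'[1,1] F (1/2)\<close> (lemma \<open>third_order_theta_deriv_at_0\<close>). As
  \<open>F' 0 = 3 \<phi>\<^sup>2 \<phi>'\<close> and \<open>F (1/2) = \<theta>[1/3, \<epsilon>' + 1]\<^sup>3\<close>, this is the claim for \<open>\<epsilon>' = 0, 2/3, 4/3\<close>,
  provided that the denominators do not vanish. For \<open>\<epsilon>' = 4/3\<close> the characteristic \<open>7/3\<close> is
  reduced to \<open>1/3\<close>, which costs a cube root of \<open>- 1\<close> and so changes the sign.

  The analytic input is the zero set of the theta functions (lemmas \<open>theta_eq_0_iff\<close> and
  \<open>deriv_theta_neq_0\<close>). All of them are translates of \<open>\<theta>[1,1]\<close> up to a factor without zeros.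
  The function \<open>\<theta>[1,1]\<close> is odd, so it vanishes on the lattice, and dividing it by the infinite product of
  Jacobi's triple product identity, which visibly has simple zeros exactly there, leaves again a
  doubly periodic entire function. So \<open>\<theta>[1,1]\<close> is a constant multiple of the product, and the
  constant is nonzero because a Fourier coefficient of \<open>\<theta>[1,1]\<close> is.
\<close>

section \<open>Entire functions with equal quasi-periods\<close>

text \<open>
  At a zero of the denominator the quotient is completed by the value from l'Hospital's rule; the
  result is continuous, and zeros are isolated, so Riemann's theorem on removable singularities
  applies near each point.
\<close>
lemma entire_quotient_simple_zeros:
  fixes f g :: "complex \<Rightarrow> complex"
  assumes f: "f holomorphic_on UNIV" and g: "g holomorphic_on UNIV"
    and nz: "g z0 \<noteq> 0"
    and zeros: "\<And>p. g p = 0 \<Longrightarrow> f p = 0 \<and> deriv g p \<noteq> 0"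
  obtains h where "h holomorphic_on UNIV" "\<And>z. f z = g z * h z"
proof
  define h where "h z = (if g z = 0 then deriv f z / deriv g z else f z / g z)" for z
  show "f z = g z * h z" for z
    using zeros[of z] by (simp add: h_def)
  have "h field_differentiable (at p)" for p
  proof -
    obtain r where r: "0 < r" "\<And>z. z \<in> ball p r - {p} \<Longrightarrow> g z \<noteq> 0"
    proof (cases "g p = 0")
      case True
      then show thesis
        using isolated_zeros[of g UNIV p z0] g nz that by auto
    next
      case False
      have "open (g -` (- {0}))"
        using g by (intro continuous_open_vimage) 
          (auto simp: continuous_on_eq_continuous_at dest: holomorphic_on_imp_continuous_on)
      then obtain r where "0 < r" "ball p r \<subseteq> g -` (- {0})"
        using False by (meson open_contains_ball vimageI ComplI singletonD)
      then show thesis by (intro that[of r]) auto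
    qed
    have "(\<lambda>z. f z / g z) holomorphic_on ball p r - {p}"
      using r by (intro holomorphic_intros holomorphic_on_subset[OF f] holomorphic_on_subset[OF g]) auto
    then have hol: "h holomorphic_on ball p r - {p}"
      by (rule holomorphic_transform) (use r in \<open>auto simp: h_def\<close>)
    have lim: "(h \<longlongrightarrow> h p) (at p)"
    proof (cases "g p = 0")
      case True
      have "((\<lambda>w. f w / g w) \<longlongrightarrow> deriv f p / deriv g p) (at p)"
        using True zeros[of p] f g
        by (intro lhopital_complex_simple[OF _ _ _ _ _ refl])
          (auto intro: holomorphic_derivI[of _ UNIV])
      moreover have "eventually (\<lambda>w. f w / g w = h w) (at p)"
        unfolding eventually_at using r by (intro exI[of _ r]) (auto simp: h_def dist_commute)
      ultimately show ?thesis
        using True by (simp add: h_def Lim_transform_eventually)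
    next
      case False
      have "isCont f p" "isCont g p"
        using f g by (auto simp: continuous_on_eq_continuous_at dest: holomorphic_on_imp_continuous_on)
      then have "((\<lambda>w. f w / g w) \<longlongrightarrow> f p / g p) (at p)"
        using False by (auto simp: isCont_def intro: tendsto_divide)
      moreover have "eventually (\<lambda>w. f w / g w = h w) (at p)"
        unfolding eventually_at using r by (intro exI[of _ r]) (auto simp: h_def dist_commute)
      ultimately show ?thesis
        using False by (simp add: h_def Lim_transform_eventually)
    qed
    have "h holomorphic_on ball p r"
      by (rule no_isolated_singularity'[where K = "{p}"])
        (use hol lim in \<open>auto intro: tendsto_within_subset\<close>)
    then show ?thesis
      using r(1) by (auto simp: holomorphic_on_open field_differentiable_def)
  qed
  then show "h holomorphic_on UNIV"
    by (simp add: holomorphic_on_def)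
qed

lemma entire_eq_0_if_mult_eq_0:
  fixes u g :: "complex \<Rightarrow> complex"
  assumes u: "u holomorphic_on UNIV" and g: "g holomorphic_on UNIV"
    and nz: "g z0 \<noteq> 0" and prod: "\<And>z. u z * g z = 0"
  shows "u z = 0"
proof -
  have op: "open (g -` (- {0}))"
    using g by (intro continuous_open_vimage)
      (auto simp: continuous_on_eq_continuous_at dest: holomorphic_on_imp_continuous_on)
  show ?thesis
    by (rule analytic_continuation_open[where f = u and g = "\<lambda>_. 0", OF op, of UNIV])
      (use u nz prod in auto)
qed

text \<open>
  Stated for an arbitrary function \<open>P\<close>, so that it serves both for periodic functions and for
  predicates, such as the vanishing of a quasi-periodic function.
\<close>
lemma lattice_invariant:
  fixes P :: "complex \<Rightarrow> 'a"
  assumes "\<And>z. P (z + 1) = P z" "\<And>z. P (z + \<tau>) = P z"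
  shows "P (z + of_int m + of_int n * \<tau>) = P z"
proof -
  have 1: "P (z + of_int k * w) = P z" if w: "\<And>z. P (z + w) = P z" for k :: int and z w
  proof (induction k rule: int_induct[where k = 0])
    case (step1 i)
    then show ?case using w[of "z + of_int i * w"] by (simp add: algebra_simps)
  next
    case (step2 i)
    then show ?case using w[of "z + of_int (i - 1) * w"] by (simp add: algebra_simps)
  qed auto
  show ?thesis
    using 1[of \<tau> "z + of_int m" n] 1[of 1 z m] assms by simp
qed

text \<open>
  All values are already taken on the closed fundamental parallelogram, which is compact; so the
  function is bounded.
\<close>
lemma entire_doubly_periodic_constant:
  assumes \<tau>: "Im \<tau> > 0" and h: "h holomorphic_on UNIV"
    and per: "\<And>z. h (z + 1) = h z" "\<And>z. h (z + \<tau>) = h z"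
  shows "\<exists>c. \<forall>z. h z = c"
proof -
  define K where "K = (\<lambda>(s, t). of_real s + of_real t * \<tau>) ` ({0..1} \<times> {0..1::real})"
  have "compact K"
    unfolding K_def by (intro compact_continuous_image compact_Times)
      (auto intro!: continuous_intros simp: case_prod_unfold)
  then have "compact (h ` K)"
    using h by (intro compact_continuous_image)
      (auto intro: holomorphic_on_imp_continuous_on holomorphic_on_subset)
  moreover have "range h \<subseteq> h ` K"
  proof safe
    fix z
    define t where "t = Im z / Im \<tau>"
    define s where "s = Re z - t * Re \<tau>"
    have z: "z = of_real s + of_real t * \<tau>"
      using \<tau> by (simp add: complex_eq_iff s_def t_def)
    have "h z = h (of_real (frac s) + of_real (frac t) * \<tau> + of_int \<lfloor>s\<rfloor> + of_int \<lfloor>t\<rfloor> * \<tau>)"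
      by (subst z) (simp add: frac_def algebra_simps)
    also have "\<dots> = h (of_real (frac s) + of_real (frac t) * \<tau>)"
      by (rule lattice_invariant) (use per in auto)
    finally have hz: "h z = h (of_real (frac s) + of_real (frac t) * \<tau>)" .
    have "of_real (frac s) + of_real (frac t) * \<tau> \<in> K"
      unfolding K_def by (rule image_eqI[of _ _ "(frac s, frac t)"])
        (auto simp: frac_lt_1 less_imp_le)
    then show "h z \<in> h ` K" unfolding hz by (rule imageI)
  qed
  ultimately have "bounded (range h)"
    using bounded_subset compact_imp_bounded by blast
  with h have "h constant_on UNIV" by (rule Liouville_theorem)
  then show ?thesis by (auto simp: constant_on_def)
qed

text \<open>
  The common multipliers cancel in the quotient. This holds first where \<open>g\<close> does not vanish, and
  everywhere by the identity theorem.
\<close>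
lemma proportional_if_same_multipliers:
  fixes f g a b :: "complex \<Rightarrow> complex"
  assumes \<tau>: "Im \<tau> > 0"
    and f: "f holomorphic_on UNIV" and g: "g holomorphic_on UNIV"
    and nz: "g z0 \<noteq> 0"
    and zeros: "\<And>p. g p = 0 \<Longrightarrow> f p = 0 \<and> deriv g p \<noteq> 0"
    and f1: "\<And>z. f (z + 1) = a z * f z" and g1: "\<And>z. g (z + 1) = a z * g z"
    and f\<tau>: "\<And>z. f (z + \<tau>) = b z * f z" and g\<tau>: "\<And>z. g (z + \<tau>) = b z * g z"
  shows "\<exists>c. \<forall>z. f z = c * g z"
proof -
  obtain h where h: "h holomorphic_on UNIV" "\<And>z. f z = g z * h z"
    using entire_quotient_simple_zeros[OF f g nz zeros] by blast
  have per: "h (z + w) = h z" 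
    if "\<And>z. f (z + w) = m z * f z" "\<And>z. g (z + w) = m z * g z" for w z m
  proof -
    have "h (z + w) - h z = 0"
    proof (rule entire_eq_0_if_mult_eq_0[where u = "\<lambda>z. h (z + w) - h z" and g = "\<lambda>z. g (z + w)"])
      show "(\<lambda>z. h (z + w) - h z) holomorphic_on UNIV" "(\<lambda>z. g (z + w)) holomorphic_on UNIV"
        by (intro holomorphic_intros holomorphic_on_compose_gen[of "\<lambda>z. z + w" UNIV _ UNIV, unfolded o_def];
            use h g in auto)+
      show "g ((z0 - w) + w) \<noteq> 0" using nz by simp
      show "(h (z + w) - h z) * g (z + w) = 0" for z
        using h(2)[of z] h(2)[of "z + w"] that[of z] by (simp add: algebra_simps)
    qed
    then show ?thesis by simp
  qed
  have "\<exists>c. \<forall>z. h z = c"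
    by (rule entire_doubly_periodic_constant[OF \<tau> h(1)])
      (use per[of 1 a] per[of \<tau> b] f1 g1 f\<tau> g\<tau> in auto)
  then show ?thesis using h(2) by (metis mult.commute)
qed

lemma simple_zeros_mult:
  fixes f g :: "complex \<Rightarrow> complex"
  assumes "f holomorphic_on UNIV" "g holomorphic_on UNIV"
    and "\<And>p. f p = 0 \<Longrightarrow> deriv f p \<noteq> 0 \<and> g p \<noteq> 0" "\<And>p. g p = 0 \<Longrightarrow> deriv g p \<noteq> 0"
    and "f p * g p = 0"
  shows "deriv (\<lambda>z. f z * g z) p \<noteq> 0"
proof -
  have "((\<lambda>z. f z * g z) has_field_derivative (deriv f p * g p + deriv g p * f p)) (at p)"
    using assms by (intro DERIV_mult holomorphic_derivI[of _ UNIV]) auto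
  then have "deriv (\<lambda>z. f z * g z) p = deriv f p * g p + deriv g p * f p"
    by (rule DERIV_imp_deriv)
  with assms(3)[of p] assms(4)[of p] assms(5) show ?thesis by auto
qed

text \<open>
  Differentiating the functional equation at a zero kills the term with the derivative of the
  multiplier, so the order of a simple zero is preserved.
\<close>
lemma simple_zero_shift:
  fixes f m :: "complex \<Rightarrow> complex"
  assumes f: "f holomorphic_on UNIV" and m: "m holomorphic_on UNIV" "m z \<noteq> 0"
    and shift: "\<And>z. f (z + w) = m z * f z"
  shows "(f (z + w) = 0 \<and> deriv f (z + w) \<noteq> 0) \<longleftrightarrow> (f z = 0 \<and> deriv f z \<noteq> 0)"
proof -
  have "((\<lambda>z. f (z + w)) has_field_derivative deriv f (z + w)) (at z)"
    using holomorphic_derivI[OF f open_UNIV UNIV_I, of "z + w" UNIV] by (simp add: DERIV_shift)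
  moreover have "((\<lambda>z. m z * f z) has_field_derivative (deriv m z * f z + deriv f z * m z)) (at z)"
    using f m by (intro DERIV_mult holomorphic_derivI[of _ UNIV]) auto
  ultimately have "deriv f (z + w) = deriv m z * f z + deriv f z * m z"
    unfolding shift by (rule DERIV_unique)
  then show ?thesis using m(2) by (auto simp: shift)
qed

section \<open>An infinite product with simple zeros on a lattice\<close>

text \<open>
  This is the \<open>q\<close>-Pochhammer symbol \<open>(x; q)\<^sub>\<infinity>\<close>.
\<close>
definition q_prod :: "complex \<Rightarrow> complex \<Rightarrow> complex" where
  "q_prod q x = (\<Prod>n. 1 - q ^ n * x)"

lemma has_prod_q_prod:
  assumes "norm q < 1"
  shows "(\<lambda>n. 1 - q ^ n * x) has_prod q_prod q x"
proof -
  have "summable (\<lambda>n. norm q ^ n * norm x)"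
    using assms by (intro summable_mult2 summable_geometric) auto
  then have "abs_convergent_prod (\<lambda>n. 1 - q ^ n * x)"
    unfolding abs_convergent_prod_conv_summable by (simp add: norm_mult norm_power)
  then show ?thesis
    unfolding q_prod_def by (intro convergent_prod_has_prod abs_convergent_prod_imp_convergent_prod)
qed

lemma q_prod_rec:
  assumes "norm q < 1"
  shows "q_prod q x = (1 - x) * q_prod q (q * x)"
proof -
  have "(\<lambda>n. 1 - q ^ Suc n * x) has_prod q_prod q (q * x)"
    using has_prod_q_prod[OF assms, of "q * x"] by (simp add: ac_simps)
  from has_prod_Suc_imp[of "\<lambda>n. 1 - q ^ n * x", OF this]
  have "(\<lambda>n. 1 - q ^ n * x) has_prod (q_prod q (q * x) * (1 - x))" by simp
  then show ?thesis
    using has_prod_q_prod[OF assms, of x] has_prod_unique2 by (metis mult.commute)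
qed

lemma q_prod_eq_0_iff:
  assumes "norm q < 1"
  shows "q_prod q x = 0 \<longleftrightarrow> (\<exists>n. q ^ n * x = 1)"
  using has_prod_eq_0_iff[OF has_prod_q_prod[OF assms, of x]] by auto

lemma holomorphic_q_prod:
  assumes "norm q < 1"
  shows "q_prod q holomorphic_on UNIV"
proof (rule holomorphic_uniform_sequence)
  show "(\<lambda>x. \<Prod>n<N. 1 - q ^ n * x) holomorphic_on UNIV" for N
    by (intro holomorphic_intros)
  fix x :: complex
  have "uniformly_convergent_on (cball x 1) (\<lambda>N x. \<Prod>n<N. 1 + - (q ^ n * x))"
  proof (rule uniformly_convergent_on_prod)
    show "uniformly_convergent_on (cball x 1) (\<lambda>N x. \<Sum>n<N. norm (- (q ^ n * x)))"
    proof (rule Weierstrass_m_test')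
      fix n z assume "z \<in> cball x 1"
      then have "norm z \<le> norm x + 1"
        using norm_triangle_ineq2[of z x] by (auto simp: dist_norm norm_minus_commute)
      then show "norm (norm (- (q ^ n * z))) \<le> norm q ^ n * (norm x + 1)"
        by (simp add: norm_mult norm_power mult_left_mono)
    next
      show "summable (\<lambda>n. norm q ^ n * (norm x + 1))"
        using assms by (intro summable_mult2 summable_geometric) auto
    qed
  qed (auto intro!: continuous_intros)
  then obtain g where g: "uniform_limit (cball x 1) (\<lambda>N x. \<Prod>n<N. 1 - q ^ n * x) g sequentially"
    by (auto simp: uniformly_convergent_on_def)
  have "g z = q_prod q z" if "z \<in> cball x 1" for z
  proof -
    have "(\<lambda>N. \<Prod>n<N. 1 - q ^ n * z) \<longlonglongrightarrow> g z"
      using tendsto_uniform_limitI[OF g that] .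
    moreover have "(\<lambda>N. \<Prod>n<N. 1 - q ^ n * z) \<longlonglongrightarrow> q_prod q z"
      using has_prod_imp_tendsto'[OF has_prod_q_prod[OF assms]] .
    ultimately show ?thesis using LIMSEQ_unique by blast
  qed
  then have "uniform_limit (cball x 1) (\<lambda>N x. \<Prod>n<N. 1 - q ^ n * x) (q_prod q) sequentially"
    using g by (subst (asm) uniform_limit_cong'[where i = "q_prod q"]) auto
  then show "\<exists>d>0. cball x d \<subseteq> UNIV \<and> 
      uniform_limit (cball x d) (\<lambda>N x. \<Prod>n<N. 1 - q ^ n * x) (q_prod q) sequentially"
    by (intro exI[of _ 1]) auto
qed auto

section \<open>The theta series\<close>
definition theta_term :: "real \<Rightarrow> real \<Rightarrow> complex \<Rightarrow> complex \<Rightarrow> int \<Rightarrow> complex" where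
  "theta_term \<epsilon> \<epsilon>' \<zeta> \<tau> n = exp (2 * of_real pi * \<i> *
        (1 / 2 * (of_int n + of_real \<epsilon> / 2)\<^sup>2 * \<tau> +
         (of_int n + of_real \<epsilon> / 2) * (\<zeta> + of_real \<epsilon>' / 2)))"

lemma theta_eq_infsum: "theta \<epsilon> \<epsilon>' \<zeta> \<tau> = (\<Sum>\<^sub>\<infinity>n. theta_term \<epsilon> \<epsilon>' \<zeta> \<tau> n)"
  by (simp add: theta_def theta_term_def)

lemma summable_on_exp_minus_abs_int: "(\<lambda>n::int. exp (- \<bar>real_of_int n\<bar>)) summable_on UNIV"
proof -
  have geo: "(\<lambda>n::nat. exp (- real n)) summable_on UNIV"
  proof (rule norm_summable_imp_summable_on)
    have "summable (\<lambda>n. exp (- 1 :: real) ^ n)"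
      by (rule summable_geometric) auto
    moreover have "exp (- 1) ^ n = norm (exp (- real n))" for n
      using exp_of_nat_mult[of n "- 1 :: real"] by simp
    ultimately show "summable (\<lambda>n. norm (exp (- real n)))" by simp
  qed
  have "(\<lambda>n. exp (- real n)) summable_on UNIV \<longleftrightarrow>
      (\<lambda>n::int. exp (- \<bar>real_of_int n\<bar>)) summable_on {0..}"
    by (rule summable_on_reindex_bij_witness[of _ nat int]) auto
  then have "(\<lambda>n::int. exp (- \<bar>real_of_int n\<bar>)) summable_on {0..}"
    using geo by simp
  moreover have "(\<lambda>n. exp (- real n)) summable_on UNIV \<longleftrightarrow>
      (\<lambda>n::int. exp (- \<bar>real_of_int n\<bar>)) summable_on {..0}"
    by (rule summable_on_reindex_bij_witness[of _ "\<lambda>n. nat (- n)" "\<lambda>n. - int n"]) auto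
  then have "(\<lambda>n::int. exp (- \<bar>real_of_int n\<bar>)) summable_on {..0}"
    using geo by simp
  then have "(\<lambda>n::int. exp (- \<bar>real_of_int n\<bar>)) summable_on {..<0}"
    by (rule summable_on_subset_banach) auto
  ultimately have "(\<lambda>n::int. exp (- \<bar>real_of_int n\<bar>)) summable_on ({0..} \<union> {..<0})"
    by (intro summable_on_Un_disjoint) auto
  moreover have "{0..} \<union> {..<0::int} = UNIV" by auto
  ultimately show ?thesis by simp
qed

text \<open>
  With \<open>m = n + \<epsilon>/2\<close> the term has norm \<open>exp (- \<pi> m\<^sup>2 Im \<tau> - 2 \<pi> m Im \<zeta>)\<close>. The Gaussian beats the linear
  term: completing the square leaves even a factor \<open>exp (- \<bar>m\<bar>)\<close> to spare, which is where the
  \<open>+ 1\<close> in the bound comes from.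
\<close>
lemma norm_theta_term_le:
  assumes \<tau>: "Im \<tau> > 0" and R: "norm \<zeta> \<le> R"
  shows "norm (theta_term \<epsilon> \<epsilon>' \<zeta> \<tau> n) \<le>
    exp ((2 * pi * R + 1)\<^sup>2 / (4 * pi * Im \<tau>) + \<bar>\<epsilon>\<bar> / 2) * exp (- \<bar>real_of_int n\<bar>)"
proof -
  define m where "m = real_of_int n + \<epsilon> / 2"
  define b where "b = 2 * pi * R + 1"
  define y where "y = Im \<tau>"
  have y: "y > 0" using \<tau> by (simp add: y_def)
  have "theta_term \<epsilon> \<epsilon>' \<zeta> \<tau> n =
      exp (2 * of_real pi * \<i> * (1 / 2 * (of_real m)\<^sup>2 * \<tau> + of_real m * (\<zeta> + of_real \<epsilon>' / 2)))"
    by (simp add: theta_term_def m_def)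
  also have "norm \<dots> = exp (- pi * m\<^sup>2 * y - 2 * pi * m * Im \<zeta>)"
  proof -
    define w where "w = 1 / 2 * of_real (m\<^sup>2) * \<tau> + of_real m * (\<zeta> + of_real \<epsilon>' / 2)"
    have "Im w = m\<^sup>2 * y / 2 + m * Im \<zeta>"
      by (simp add: w_def y_def flip: of_real_mult)
    then have "Re (2 * of_real pi * \<i> * w) = - pi * m\<^sup>2 * y - 2 * pi * m * Im \<zeta>"
      by (simp add: algebra_simps)
    then show ?thesis
      by (simp add: w_def)
  qed
  also have "- pi * m\<^sup>2 * y - 2 * pi * m * Im \<zeta> \<le> b\<^sup>2 / (4 * pi * y) + \<bar>\<epsilon>\<bar> / 2 - \<bar>real_of_int n\<bar>"
  proof -
    have "- (m * Im \<zeta>) \<le> \<bar>m\<bar> * \<bar>Im \<zeta>\<bar>"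
      by (simp flip: abs_mult)
    also have "\<dots> \<le> \<bar>m\<bar> * R"
      using R abs_Im_le_cmod[of \<zeta>] by (intro mult_left_mono) auto
    finally have "- (m * Im \<zeta>) \<le> \<bar>m\<bar> * R" .
    then have 1: "- (2 * pi * m * Im \<zeta>) \<le> 2 * pi * R * \<bar>m\<bar>"
      using mult_left_mono[of "- (m * Im \<zeta>)" "\<bar>m\<bar> * R" "2 * pi"] by (simp add: mult_ac)
    \<comment> \<open>Completing the square in \<open>\<bar>m\<bar>\<close>.\<close>
    have "0 \<le> (2 * pi * y * \<bar>m\<bar> - b)\<^sup>2 / (4 * pi * y)"
      using y by simp
    also have "\<dots> = pi * m\<^sup>2 * y - b * \<bar>m\<bar> + b\<^sup>2 / (4 * pi * y)"
      using y by (simp add: power2_diff power_mult_distrib field_simps power2_eq_square)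
    finally have 2: "- pi * m\<^sup>2 * y \<le> b\<^sup>2 / (4 * pi * y) - b * \<bar>m\<bar>" by simp
    have 3: "\<bar>real_of_int n\<bar> \<le> \<bar>m\<bar> + \<bar>\<epsilon>\<bar> / 2"
      by (simp add: m_def)
    have 4: "b * \<bar>m\<bar> = 2 * pi * R * \<bar>m\<bar> + \<bar>m\<bar>"
      by (simp add: b_def algebra_simps)
    show ?thesis using 1 2 3 4 by linarith
  qed
  finally show ?thesis
    by (simp add: b_def y_def flip: exp_add)
qed

lemma summable_theta_bound:
  "(\<lambda>n::int. C * exp (- \<bar>real_of_int n\<bar>)) summable_on UNIV"
  by (intro summable_on_cmult_right summable_on_exp_minus_abs_int)

text \<open>
  The limit is along the finite sets of integers, which is the meaning of the unordered sum in the
  definition of \<open>theta\<close>.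
\<close>
lemma uniform_limit_theta:
  assumes "Im \<tau> > 0"
  shows "uniform_limit (cball 0 R) (\<lambda>X \<zeta>. \<Sum>n\<in>X. theta_term \<epsilon> \<epsilon>' \<zeta> \<tau> n)
     (\<lambda>\<zeta>. theta \<epsilon> \<epsilon>' \<zeta> \<tau>) (finite_subsets_at_top UNIV)"
  unfolding theta_eq_infsum
  by (rule Weierstrass_m_test_general[OF norm_theta_term_le[OF assms] summable_theta_bound]) auto

lemma holomorphic_theta_UNIV:
  assumes "Im \<tau> > 0"
  shows "(\<lambda>\<zeta>. theta \<epsilon> \<epsilon>' \<zeta> \<tau>) holomorphic_on UNIV"
proof -
  have "(\<lambda>\<zeta>. theta \<epsilon> \<epsilon>' \<zeta> \<tau>) holomorphic_on ball 0 R" for R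
  proof (rule holomorphic_uniform_limit[OF _ uniform_limit_theta[OF assms]])
    have "(\<lambda>\<zeta>. \<Sum>n\<in>X. theta_term \<epsilon> \<epsilon>' \<zeta> \<tau> n) holomorphic_on UNIV" for X
      unfolding theta_term_def by (intro holomorphic_intros)
    then show "\<forall>\<^sub>F X in finite_subsets_at_top UNIV.
        continuous_on (cball 0 R) (\<lambda>\<zeta>. \<Sum>n\<in>X. theta_term \<epsilon> \<epsilon>' \<zeta> \<tau> n) \<and>
        (\<lambda>\<zeta>. \<Sum>n\<in>X. theta_term \<epsilon> \<epsilon>' \<zeta> \<tau> n) holomorphic_on ball 0 R"
      by (intro always_eventually allI conjI holomorphic_on_imp_continuous_on)
         (auto intro: holomorphic_on_subset)
  qed auto
  then have "(\<lambda>\<zeta>. theta \<epsilon> \<epsilon>' \<zeta> \<tau>) field_differentiable (at z)" for z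
    by (rule holomorphic_on_imp_differentiable_at[of _ "ball 0 (norm z + 1)"]) auto
  then show ?thesis by (simp add: holomorphic_on_def)
qed

lemma exp_2_pi_i_int: "exp (2 * of_real pi * \<i> * of_int n) = 1"
  using exp_integer_2pi[of "of_int n"] by (simp add: mult_ac)

lemma theta_add_1: "theta \<epsilon> \<epsilon>' (\<zeta> + 1) \<tau> = exp (of_real pi * \<i> * of_real \<epsilon>) * theta \<epsilon> \<epsilon>' \<zeta> \<tau>"
proof -
  have "theta_term \<epsilon> \<epsilon>' (\<zeta> + 1) \<tau> n = exp (of_real pi * \<i> * of_real \<epsilon>) * theta_term \<epsilon> \<epsilon>' \<zeta> \<tau> n" for n
  proof -
    have "theta_term \<epsilon> \<epsilon>' (\<zeta> + 1) \<tau> n = 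
      exp (2 * of_real pi * \<i> * of_int n) * (exp (of_real pi * \<i> * of_real \<epsilon>) * theta_term \<epsilon> \<epsilon>' \<zeta> \<tau> n)"
      unfolding theta_term_def exp_add [symmetric] by (rule arg_cong[of _ _ exp]) (simp add: field_simps)
    then show ?thesis by (simp add: exp_2_pi_i_int)
  qed
  then show ?thesis
    by (simp add: theta_eq_infsum infsum_cmult_right')
qed

lemma theta_add_\<tau>:
  "theta \<epsilon> \<epsilon>' (\<zeta> + \<tau>) \<tau> =
     exp (- of_real pi * \<i> * (\<tau> + 2 * \<zeta> + of_real \<epsilon>')) * theta \<epsilon> \<epsilon>' \<zeta> \<tau>"
proof -
  have "theta_term \<epsilon> \<epsilon>' (\<zeta> + \<tau>) \<tau> n =
      exp (- of_real pi * \<i> * (\<tau> + 2 * \<zeta> + of_real \<epsilon>')) * theta_term \<epsilon> \<epsilon>' \<zeta> \<tau> (n + 1)" for n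
    unfolding theta_term_def exp_add [symmetric]
    by (rule arg_cong[of _ _ exp]) (simp add: field_simps power2_eq_square)
  moreover have "(\<Sum>\<^sub>\<infinity>n. theta_term \<epsilon> \<epsilon>' \<zeta> \<tau> (n + 1)) = (\<Sum>\<^sub>\<infinity>n. theta_term \<epsilon> \<epsilon>' \<zeta> \<tau> n)"
    by (rule infsum_reindex_bij_betw) (rule bij_betwI[where g = "\<lambda>n. n - 1"], auto)
  ultimately show ?thesis
    by (simp add: theta_eq_infsum infsum_cmult_right')
qed

lemma theta_add_half: "theta \<epsilon> \<epsilon>' (\<zeta> + 1 / 2) \<tau> = theta \<epsilon> (\<epsilon>' + 1) \<zeta> \<tau>"
  unfolding theta_eq_infsum theta_term_def by (simp add: field_simps)

lemma theta_char_add_2: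
  "theta \<epsilon> (\<epsilon>' + 2) \<zeta> \<tau> = exp (of_real pi * \<i> * of_real \<epsilon>) * theta \<epsilon> \<epsilon>' \<zeta> \<tau>"
proof -
  have "theta \<epsilon> (\<epsilon>' + 2) \<zeta> \<tau> = theta \<epsilon> \<epsilon>' (\<zeta> + 1) \<tau>"
    unfolding theta_eq_infsum theta_term_def by (simp add: add_divide_distrib add_ac)
  then show ?thesis by (simp only: theta_add_1)
qed

lemma theta_1_1_minus: "theta 1 1 (- \<zeta>) \<tau> = - theta 1 1 \<zeta> \<tau>"
proof -
  have "theta_term 1 1 (- \<zeta>) \<tau> n = - theta_term 1 1 \<zeta> \<tau> (- n - 1)" for n
  proof -
    have "theta_term 1 1 (- \<zeta>) \<tau> n =
        exp (2 * of_real pi * \<i> * of_int n) * (exp (of_real pi * \<i>) * theta_term 1 1 \<zeta> \<tau> (- n - 1))"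
      unfolding theta_term_def exp_add [symmetric] 
      by (rule arg_cong[of _ _ exp]) (simp add: field_simps power2_eq_square)
    then show ?thesis by (simp add: exp_2_pi_i_int)
  qed
  moreover have "(\<Sum>\<^sub>\<infinity>n. - theta_term 1 1 \<zeta> \<tau> (- n - 1)) = (\<Sum>\<^sub>\<infinity>n. - theta_term 1 1 \<zeta> \<tau> n)"
    by (rule infsum_reindex_bij_betw[where f = "\<lambda>n. - theta_term 1 1 \<zeta> \<tau> n"])
      (rule bij_betwI[where g = "\<lambda>n. - n - 1"], auto)
  ultimately show ?thesis
    by (simp add: theta_eq_infsum infsum_uminus)
qed

text \<open>
  With \<open>\<delta> = (\<epsilon> - 1)/2\<close> the summation variable is \<open>n + \<epsilon>/2 = (n + 1/2) + \<delta>\<close>; the exponent is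
  expanded around \<open>n + 1/2\<close>, and what does not depend on \<open>n\<close> is the factor in front. It has no zeros,
  so every statement about zeros reduces to the characteristic \<open>[1, 1]\<close>.
\<close>
lemma theta_eq_theta_1_1:
  "theta \<epsilon> \<epsilon>' \<zeta> \<tau> = exp (of_real pi * \<i> * of_real (\<epsilon> - 1) *
       (of_real (\<epsilon> - 1) / 4 * \<tau> + \<zeta> + of_real \<epsilon>' / 2)) *
     theta 1 1 (\<zeta> + of_real (\<epsilon> - 1) / 2 * \<tau> + of_real (\<epsilon>' - 1) / 2) \<tau>"
proof -
  have "theta_term \<epsilon> \<epsilon>' \<zeta> \<tau> n = exp (of_real pi * \<i> * of_real (\<epsilon> - 1) *
       (of_real (\<epsilon> - 1) / 4 * \<tau> + \<zeta> + of_real \<epsilon>' / 2)) *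
     theta_term 1 1 (\<zeta> + of_real (\<epsilon> - 1) / 2 * \<tau> + of_real (\<epsilon>' - 1) / 2) \<tau> n" for n
    unfolding theta_term_def exp_add [symmetric]
    by (rule arg_cong[of _ _ exp]) (simp add: field_simps power2_eq_square)
  then show ?thesis
    by (simp add: theta_eq_infsum infsum_cmult_right')
qed

text \<open>
  On the real axis \<open>exp (- \<pi> \<i> \<epsilon> x) \<theta>[\<epsilon>, \<epsilon>'](x)\<close> is a uniformly convergent Fourier series. Its mean over
  \<open>[0, 1]\<close> is the constant coefficient, which is an exponential and hence not zero.
\<close>
lemma theta_not_identically_0:
  assumes "Im \<tau> > 0"
  shows "\<exists>\<zeta>. theta \<epsilon> \<epsilon>' \<zeta> \<tau> \<noteq> 0"
proof (rule ccontr)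
  assume "\<not> ?thesis"
  then have zero: "theta \<epsilon> \<epsilon>' \<zeta> \<tau> = 0" for \<zeta> by auto
  \<comment> \<open>The Fourier coefficients; their absolute values are the norms of the terms at \<open>\<zeta> = 0\<close>.\<close>
  define a where "a n = theta_term \<epsilon> \<epsilon>' 0 \<tau> n" for n
  have split: "theta_term \<epsilon> \<epsilon>' (of_real x) \<tau> n * exp (- of_real pi * \<i> * of_real \<epsilon> * of_real x) =
      a n * exp (2 * of_real pi * \<i> * of_int n * of_real x)" for x n
    unfolding theta_term_def a_def exp_add [symmetric]
    by (rule arg_cong[of _ _ exp]) (simp add: field_simps)
  have ul: "uniform_limit {0..1} (\<lambda>X x::real. \<Sum>n\<in>X. a n * exp (2 * of_real pi * \<i> * of_int n * of_real x))
     (\<lambda>x. 0) (finite_subsets_at_top UNIV)"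
  proof -
    have "uniform_limit {0..1} (\<lambda>X x::real. \<Sum>n\<in>X. a n * exp (2 * of_real pi * \<i> * of_int n * of_real x))
      (\<lambda>x. \<Sum>\<^sub>\<infinity>n. a n * exp (2 * of_real pi * \<i> * of_int n * of_real x)) (finite_subsets_at_top UNIV)"
    proof (rule Weierstrass_m_test_general[OF _ summable_theta_bound])
      fix n and x :: real
      show "norm (a n * exp (2 * of_real pi * \<i> * of_int n * of_real x)) \<le>
         exp ((2 * pi * 0 + 1)\<^sup>2 / (4 * pi * Im \<tau>) + \<bar>\<epsilon>\<bar> / 2) * exp (- \<bar>real_of_int n\<bar>)"
        using norm_theta_term_le[OF assms, of 0 0 \<epsilon> \<epsilon>' n] by (simp add: norm_mult a_def)
    qed
    moreover have "(\<Sum>\<^sub>\<infinity>n. a n * exp (2 * of_real pi * \<i> * of_int n * of_real x)) = 0" for x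
      unfolding split [symmetric] infsum_cmult_left' 
      using zero by (simp add: theta_eq_infsum)
    ultimately show ?thesis by simp
  qed
  obtain I J where IJ:
    "\<And>X. ((\<lambda>x::real. \<Sum>n\<in>X. a n * exp (2 * of_real pi * \<i> * of_int n * of_real x)) has_integral I X) {0..1}"
    "((\<lambda>x::real. 0 :: complex) has_integral J) {0..1}"
    "(I \<longlongrightarrow> J) (finite_subsets_at_top UNIV)"
    by (rule uniform_limit_integral[OF ul]) (auto intro!: continuous_intros)
  have "J = 0"
    using IJ(2) by (simp add: has_integral_0_eq)
  have int: "((\<lambda>x::real. exp (2 * of_real pi * \<i> * of_int n * of_real x)) has_integral (if n = 0 then 1 else 0)) {0..1}" for n :: int
  proof (cases "n = 0")
    case True
    then show ?thesis using has_integral_const_real[of "1::complex" 0 1] by simp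
  next
    case False
    define w where "w = 2 * of_real pi * \<i> * of_int n"
    have w: "w \<noteq> 0" "exp w = 1" using False by (auto simp: w_def exp_2_pi_i_int)
    have "((\<lambda>x::real. exp (w * of_real x)) has_integral 
        (exp (w * of_real 1) / w - exp (w * of_real 0) / w)) {0..1}"
    proof (rule fundamental_theorem_of_calculus)
      fix x :: real
      have "((\<lambda>z. exp (w * z) / w) has_field_derivative exp (w * of_real x)) (at (of_real x))"
        using w by (auto intro!: derivative_eq_intros)
      then show "((\<lambda>x::real. exp (w * of_real x) / w) has_vector_derivative exp (w * of_real x)) 
          (at x within {0..1})"
        by (rule has_vector_derivative_real_field)
    qed auto
    then show ?thesis using w False by (simp add: w_def)
  qed
  have I: "I X = a 0" if "finite X" "0 \<in> X" for X
  proof -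
    have "((\<lambda>x::real. \<Sum>n\<in>X. a n * exp (2 * of_real pi * \<i> * of_int n * of_real x)) has_integral 
       (\<Sum>n\<in>X. a n * (if n = 0 then 1 else 0))) {0..1}"
      by (intro has_integral_sum that has_integral_mult_right int)
    then have "I X = (\<Sum>n\<in>X. a n * (if n = 0 then 1 else 0))"
      using IJ(1)[of X] has_integral_unique by blast
    also have "\<dots> = a 0" using that by (simp add: if_distrib[of "(*) _"] sum.delta cong: if_cong)
    finally show ?thesis .
  qed
  have "\<forall>\<^sub>F X in finite_subsets_at_top UNIV. I X = a 0"
    unfolding eventually_finite_subsets_at_top using I by (intro exI[of _ "{0}"]) auto
  then have "(I \<longlongrightarrow> a 0) (finite_subsets_at_top UNIV)"
    by (rule tendsto_eventually)
  then have "a 0 = J"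
    using IJ(3) by (rule tendsto_unique[rotated]) auto
  then show False
    using \<open>J = 0\<close> by (simp add: a_def theta_term_def)
qed

section \<open>Zeros of the theta functions\<close>

text \<open>
  With \<open>q = exp (2 \<pi> \<i> \<tau>)\<close> and \<open>x = exp (2 \<pi> \<i> z)\<close> this is \<open>x\<^bsup>-1/2\<^esup> (x; q)\<^sub>\<infinity> (q/x; q)\<^sub>\<infinity>\<close>, the product side of
  Jacobi's triple product identity up to a factor that depends only on \<open>\<tau>\<close>. The power of \<open>x\<close> gives it
  the same multipliers as \<open>\<theta>[1,1]\<close>.
\<close>
definition jacobi_prod :: "complex \<Rightarrow> complex \<Rightarrow> complex" where
  "jacobi_prod \<tau> z = exp (- of_real pi * \<i> * z) *
     q_prod (exp (2 * of_real pi * \<i> * \<tau>)) (exp (2 * of_real pi * \<i> * z)) *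
     q_prod (exp (2 * of_real pi * \<i> * \<tau>)) (exp (2 * of_real pi * \<i> * (\<tau> - z)))"

lemma norm_nome_less_1: "Im \<tau> > 0 \<Longrightarrow> norm (exp (2 * of_real pi * \<i> * \<tau>)) < 1"
  by (simp add: zero_less_mult_iff)

lemma exp_2_pi_i_eq_1_iff: "exp (2 * of_real pi * \<i> * z) = 1 \<longleftrightarrow> (\<exists>n::int. z = of_int n)"
proof
  assume "exp (2 * of_real pi * \<i> * z) = 1"
  then obtain n :: int where "Im z = 0" "2 * pi * Re z = of_int (2 * n) * pi"
    by (auto simp: exp_eq_1)
  then have "z = of_int n" by (simp add: complex_eq_iff)
  then show "\<exists>n::int. z = of_int n" ..
qed (auto simp: exp_2_pi_i_int)

context
  fixes \<tau> :: complex
  assumes \<tau>: "Im \<tau> > 0"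
begin

lemma holomorphic_q_prod_exp:
  assumes "f holomorphic_on UNIV"
  shows "(\<lambda>z. q_prod (exp (2 * of_real pi * \<i> * \<tau>)) (exp (f z))) holomorphic_on UNIV"
  by (rule holomorphic_on_compose_gen[OF _ holomorphic_q_prod[OF norm_nome_less_1[OF \<tau>]], unfolded o_def])
    (auto intro!: holomorphic_intros assms)

lemma holomorphic_jacobi_prod: "jacobi_prod \<tau> holomorphic_on UNIV"
  unfolding jacobi_prod_def [abs_def]
  by (intro holomorphic_intros holomorphic_q_prod_exp)

lemma jacobi_prod_add_1: "jacobi_prod \<tau> (z + 1) = - jacobi_prod \<tau> z"
proof -
  have 1: "exp (2 * of_real pi * \<i> * (w + of_int n)) = exp (2 * of_real pi * \<i> * w)" for w n
    by (simp only: distrib_left exp_add exp_2_pi_i_int mult_1_right)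
  have 2: "exp (- of_real pi * \<i> * (z + 1)) = - exp (- of_real pi * \<i> * z)"
    by (simp add: distrib_left exp_diff exp_minus)
  show ?thesis
    using 1[of z 1] 1[of "\<tau> - z" "-1"] unfolding jacobi_prod_def 2 by (simp add: algebra_simps)
qed

text \<open>
  The translation replaces \<open>x\<close> by \<open>q x\<close>: the first product loses the factor \<open>1 - x\<close> and the second one
  gains \<open>1 - 1/x = - (1 - x)/x\<close>.
\<close>
lemma jacobi_prod_add_\<tau>:
  "jacobi_prod \<tau> (z + \<tau>) = - exp (- of_real pi * \<i> * (\<tau> + 2 * z)) * jacobi_prod \<tau> z"
proof -
  define q where "q = exp (2 * of_real pi * \<i> * \<tau>)"
  define x where "x = exp (2 * of_real pi * \<i> * z)"
  have q: "norm q < 1" using norm_nome_less_1[OF \<tau>] by (simp add: q_def)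
  have x: "x \<noteq> 0" by (simp add: x_def)
  have e1: "exp (2 * of_real pi * \<i> * (z + \<tau>)) = q * x"
    by (simp add: q_def x_def distrib_left exp_add)
  have e2: "exp (2 * of_real pi * \<i> * (\<tau> - (z + \<tau>))) = inverse x"
    by (simp add: x_def exp_minus)
  have e3: "exp (2 * of_real pi * \<i> * (\<tau> - z)) = q * inverse x"
    by (simp add: q_def x_def right_diff_distrib exp_diff divide_inverse)
  have e4: "exp (- of_real pi * \<i> * (\<tau> + 2 * z)) * exp (- of_real pi * \<i> * z) =
      exp (- of_real pi * \<i> * (z + \<tau>)) * inverse x"
    unfolding x_def exp_minus [symmetric] exp_add [symmetric]
    by (rule arg_cong[of _ _ exp]) (simp add: algebra_simps)
  have "jacobi_prod \<tau> (z + \<tau>) =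
      exp (- of_real pi * \<i> * (z + \<tau>)) * q_prod q (q * x) * q_prod q (inverse x)"
    unfolding jacobi_prod_def e1 e2 by (simp add: q_def)
  also have "q_prod q (inverse x) = (1 - inverse x) * q_prod q (q * inverse x)"
    by (rule q_prod_rec[OF q])
  also have "1 - inverse x = - inverse x * (1 - x)"
    using x by (simp add: field_simps)
  also have "exp (- of_real pi * \<i> * (z + \<tau>)) * q_prod q (q * x) *
        (- inverse x * (1 - x) * q_prod q (q * inverse x)) =
      - (exp (- of_real pi * \<i> * (z + \<tau>)) * inverse x) * ((1 - x) * q_prod q (q * x)) * q_prod q (q * inverse x)"
    by (simp add: mult_ac)
  also have "\<dots> = - exp (- of_real pi * \<i> * (\<tau> + 2 * z)) * jacobi_prod \<tau> z"
    unfolding jacobi_prod_def e3 e4 [symmetric] q_prod_rec[OF q, of x, symmetric]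
    unfolding q_def [symmetric] x_def [symmetric] by (simp add: mult_ac)
  finally show ?thesis .
qed

lemma jacobi_prod_zeroD:
  assumes "jacobi_prod \<tau> z = 0"
  shows "\<exists>m n::int. z = of_int m + of_int n * \<tau>"
proof -
  define q where "q = exp (2 * of_real pi * \<i> * \<tau>)"
  have q: "norm q < 1" using norm_nome_less_1[OF \<tau>] by (simp add: q_def)
  have pow: "q ^ k * exp (2 * of_real pi * \<i> * w) = exp (2 * of_real pi * \<i> * (of_nat k * \<tau> + w))" for k w
    by (simp add: q_def distrib_left exp_add mult_ac flip: exp_of_nat_mult)
  from assms consider k where "q ^ k * exp (2 * of_real pi * \<i> * z) = 1"
    | k where "q ^ k * exp (2 * of_real pi * \<i> * (\<tau> - z)) = 1"
    by (auto simp: jacobi_prod_def q_prod_eq_0_iff[OF q[unfolded q_def]] q_def)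
  then show ?thesis
  proof cases
    case 1
    then obtain n :: int where "of_nat k * \<tau> + z = of_int n"
      by (auto simp: pow exp_2_pi_i_eq_1_iff)
    then have "z = of_int n + of_int (- int k) * \<tau>" by (simp add: algebra_simps)
    then show ?thesis by blast
  next
    case 2
    then obtain n :: int where "of_nat k * \<tau> + (\<tau> - z) = of_int n"
      by (auto simp: pow exp_2_pi_i_eq_1_iff)
    then have "z = of_int (- n) + of_int (int k + 1) * \<tau>" by (simp add: algebra_simps)
    then show ?thesis by blast
  qed
qed

text \<open>
  Splitting off the factor \<open>1 - x\<close> exhibits the zero at \<open>0\<close>; the cofactor \<open>B\<close> takes the value
  \<open>((q; q)\<^sub>\<infinity>)\<^sup>2\<close> there, which does not vanish since no power of \<open>q\<close> is \<open>1\<close>.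
\<close>
lemma jacobi_prod_0: "jacobi_prod \<tau> 0 = 0" and deriv_jacobi_prod_0: "deriv (jacobi_prod \<tau>) 0 \<noteq> 0"
proof -
  define q where "q = exp (2 * of_real pi * \<i> * \<tau>)"
  have q: "norm q < 1" using norm_nome_less_1[OF \<tau>] by (simp add: q_def)
  define B where "B z = exp (- of_real pi * \<i> * z) *
     q_prod q (exp (2 * of_real pi * \<i> * (z + \<tau>))) * q_prod q (exp (2 * of_real pi * \<i> * (\<tau> - z)))" for z
  have B: "B holomorphic_on UNIV"
    unfolding B_def [abs_def] q_def by (intro holomorphic_intros holomorphic_q_prod_exp)
  have eq: "jacobi_prod \<tau> = (\<lambda>z. (1 - exp (2 * of_real pi * \<i> * z)) * B z)"
  proof
    fix z
    have e: "exp (2 * of_real pi * \<i> * (z + \<tau>)) = q * exp (2 * of_real pi * \<i> * z)"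
      by (simp add: q_def distrib_left exp_add)
    show "jacobi_prod \<tau> z = (1 - exp (2 * of_real pi * \<i> * z)) * B z"
      unfolding jacobi_prod_def B_def e q_def [symmetric]
      by (subst q_prod_rec[OF q]) (simp add: mult_ac)
  qed
  show "jacobi_prod \<tau> 0 = 0" by (simp add: eq)
  have B0: "B 0 \<noteq> 0"
  proof -
    have "q ^ n * q \<noteq> 1" for n
    proof
      assume "q ^ n * q = 1"
      then have "norm q ^ Suc n = 1" by (metis norm_one norm_power power_Suc2)
      moreover have "norm q ^ Suc n < 1" using q by (intro power_Suc_less_one) (auto simp: q_def)
      ultimately show False by simp
    qed
    then have "q_prod q q \<noteq> 0" by (simp add: q_prod_eq_0_iff[OF q])
    then show ?thesis by (simp add: B_def q_def)
  qed
  have "(jacobi_prod \<tau> has_field_derivative - (2 * of_real pi * \<i>) * B 0) (at 0)"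
    unfolding eq
    by (rule derivative_eq_intros refl holomorphic_derivI[OF B] | simp)+
  then show "deriv (jacobi_prod \<tau>) 0 \<noteq> 0"
    using B0 by (auto dest!: DERIV_imp_deriv)
qed

lemma jacobi_prod_lattice:
  "jacobi_prod \<tau> (of_int m + of_int n * \<tau>) = 0 \<and> deriv (jacobi_prod \<tau>) (of_int m + of_int n * \<tau>) \<noteq> 0"
proof -
  have "(jacobi_prod \<tau> (0 + of_int m + of_int n * \<tau>) = 0 \<and> deriv (jacobi_prod \<tau>) (0 + of_int m + of_int n * \<tau>) \<noteq> 0)
    = (jacobi_prod \<tau> 0 = 0 \<and> deriv (jacobi_prod \<tau>) 0 \<noteq> 0)"
  proof (rule lattice_invariant[where P = "\<lambda>z. jacobi_prod \<tau> z = 0 \<and> deriv (jacobi_prod \<tau>) z \<noteq> 0"])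
    fix z
    show "(jacobi_prod \<tau> (z + 1) = 0 \<and> deriv (jacobi_prod \<tau>) (z + 1) \<noteq> 0) =
        (jacobi_prod \<tau> z = 0 \<and> deriv (jacobi_prod \<tau>) z \<noteq> 0)"
      by (rule simple_zero_shift[where m = "\<lambda>_. - 1"])
        (auto simp: holomorphic_jacobi_prod jacobi_prod_add_1)
    show "(jacobi_prod \<tau> (z + \<tau>) = 0 \<and> deriv (jacobi_prod \<tau>) (z + \<tau>) \<noteq> 0) =
        (jacobi_prod \<tau> z = 0 \<and> deriv (jacobi_prod \<tau>) z \<noteq> 0)"
    proof (rule simple_zero_shift[OF holomorphic_jacobi_prod _ _ jacobi_prod_add_\<tau>])
      show "(\<lambda>z. - exp (- of_real pi * \<i> * (\<tau> + 2 * z))) holomorphic_on UNIV"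
        by (intro holomorphic_intros)
    qed simp
  qed
  then show ?thesis
    using jacobi_prod_0 deriv_jacobi_prod_0 by simp
qed

text \<open>
  Jacobi's triple product identity with an unspecified constant. Its point is that the zeros can be
  read off from the right-hand side.
\<close>
lemma theta_1_1_eq_jacobi_prod: "\<exists>c. c \<noteq> 0 \<and> (\<forall>z. theta 1 1 z \<tau> = c * jacobi_prod \<tau> z)"
proof -
  have th0: "theta 1 1 0 \<tau> = 0"
    using theta_1_1_minus[of 0 \<tau>] by simp
  have lat: "theta 1 1 (of_int m + of_int n * \<tau>) \<tau> = 0" for m n :: int
  proof -
    have "(theta 1 1 (0 + of_int m + of_int n * \<tau>) \<tau> = 0) = (theta 1 1 0 \<tau> = 0)"
      by (rule lattice_invariant[where P = "\<lambda>z. theta 1 1 z \<tau> = 0"])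
        (simp_all add: theta_add_1 theta_add_\<tau>)
    then show ?thesis using th0 by simp
  qed
  obtain z0 where z0: "jacobi_prod \<tau> z0 \<noteq> 0"
  proof (rule ccontr)
    assume "\<not> thesis"
    then have "jacobi_prod \<tau> = (\<lambda>_. 0)" using that by blast
    then show False using deriv_jacobi_prod_0 by simp
  qed
  have "\<exists>c. \<forall>z. theta 1 1 z \<tau> = c * jacobi_prod \<tau> z"
  proof (rule proportional_if_same_multipliers[OF \<tau> holomorphic_theta_UNIV[OF \<tau>] holomorphic_jacobi_prod z0])
    fix p assume "jacobi_prod \<tau> p = 0"
    then obtain m n :: int where "p = of_int m + of_int n * \<tau>"
      using jacobi_prod_zeroD by blast
    then show "theta 1 1 p \<tau> = 0 \<and> deriv (jacobi_prod \<tau>) p \<noteq> 0"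
      using lat jacobi_prod_lattice by simp
  next
    fix z
    show "theta 1 1 (z + 1) \<tau> = - 1 * theta 1 1 z \<tau>"
      by (simp add: theta_add_1)
    show "jacobi_prod \<tau> (z + 1) = - 1 * jacobi_prod \<tau> z"
      by (simp add: jacobi_prod_add_1)
    show "jacobi_prod \<tau> (z + \<tau>) = - exp (- of_real pi * \<i> * (\<tau> + 2 * z)) * jacobi_prod \<tau> z"
      by (rule jacobi_prod_add_\<tau>)
    have "exp (- of_real pi * \<i> * (\<tau> + 2 * z + 1)) = - exp (- of_real pi * \<i> * (\<tau> + 2 * z))"
      by (simp add: distrib_left exp_diff)
    then show "theta 1 1 (z + \<tau>) \<tau> = - exp (- of_real pi * \<i> * (\<tau> + 2 * z)) * theta 1 1 z \<tau>"
      by (simp add: theta_add_\<tau>)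
  qed
  then obtain c where c: "\<forall>z. theta 1 1 z \<tau> = c * jacobi_prod \<tau> z" ..
  with theta_not_identically_0[OF \<tau>, of 1 1] have "c \<noteq> 0" by auto
  with c show ?thesis by blast
qed

lemma theta_1_1_eq_0_iff: "theta 1 1 z \<tau> = 0 \<longleftrightarrow> (\<exists>m n::int. z = of_int m + of_int n * \<tau>)"
  using theta_1_1_eq_jacobi_prod jacobi_prod_zeroD jacobi_prod_lattice by auto

lemma deriv_theta_1_1_neq_0:
  assumes "theta 1 1 z \<tau> = 0"
  shows "deriv (\<lambda>z. theta 1 1 z \<tau>) z \<noteq> 0"
proof -
  obtain c where c: "c \<noteq> 0" "(\<lambda>z. theta 1 1 z \<tau>) = (\<lambda>z. c * jacobi_prod \<tau> z)"
    using theta_1_1_eq_jacobi_prod by blast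
  have "((\<lambda>z. c * jacobi_prod \<tau> z) has_field_derivative c * deriv (jacobi_prod \<tau>) z) (at z)"
    by (intro DERIV_cmult holomorphic_derivI[OF holomorphic_jacobi_prod]) auto
  then have "deriv (\<lambda>z. theta 1 1 z \<tau>) z = c * deriv (jacobi_prod \<tau>) z"
    unfolding c(2) by (rule DERIV_imp_deriv)
  moreover obtain m n :: int where "z = of_int m + of_int n * \<tau>"
    using assms theta_1_1_eq_0_iff by blast
  ultimately show ?thesis using c(1) jacobi_prod_lattice by simp
qed

lemma theta_eq_0_iff:
  "theta \<epsilon> \<epsilon>' z \<tau> = 0 \<longleftrightarrow>
    (\<exists>m n::int. z + of_real (\<epsilon> - 1) / 2 * \<tau> + of_real (\<epsilon>' - 1) / 2 = of_int m + of_int n * \<tau>)"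
  by (subst theta_eq_theta_1_1) (simp add: theta_1_1_eq_0_iff)

lemma deriv_theta_neq_0:
  assumes "theta \<epsilon> \<epsilon>' z \<tau> = 0"
  shows "deriv (\<lambda>z. theta \<epsilon> \<epsilon>' z \<tau>) z \<noteq> 0"
proof -
  define w where "w = of_real (\<epsilon> - 1) / 2 * \<tau> + of_real (\<epsilon>' - 1) / (2 :: complex)"
  define E where "E z = exp (of_real pi * \<i> * of_real (\<epsilon> - 1) *
       (of_real (\<epsilon> - 1) / 4 * \<tau> + z + of_real \<epsilon>' / 2))" for z
  have E: "E holomorphic_on UNIV" unfolding E_def [abs_def] by (intro holomorphic_intros)
  have eq: "(\<lambda>z. theta \<epsilon> \<epsilon>' z \<tau>) = (\<lambda>z. E z * theta 1 1 (z + w) \<tau>)"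
    by (rule ext, subst theta_eq_theta_1_1) (simp add: E_def w_def add_ac)
  have E0: "E z \<noteq> 0" for z by (simp add: E_def)
  have 0: "theta 1 1 (z + w) \<tau> = 0"
    using assms fun_cong[OF eq, of z] E0[of z] by simp
  have "((\<lambda>z. theta 1 1 (z + w) \<tau>) has_field_derivative deriv (\<lambda>z. theta 1 1 z \<tau>) (z + w)) (at z)"
    using holomorphic_derivI[OF holomorphic_theta_UNIV[OF \<tau>, of 1 1] open_UNIV UNIV_I, of "z + w" UNIV]
    by (simp add: DERIV_shift)
  with E have "((\<lambda>z. E z * theta 1 1 (z + w) \<tau>) has_field_derivative
      deriv E z * theta 1 1 (z + w) \<tau> + deriv (\<lambda>z. theta 1 1 z \<tau>) (z + w) * E z) (at z)"
    by (intro DERIV_mult holomorphic_derivI[of _ UNIV]) auto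
  then have "deriv (\<lambda>z. theta \<epsilon> \<epsilon>' z \<tau>) z = deriv (\<lambda>z. theta 1 1 z \<tau>) (z + w) * E z"
    unfolding eq using 0 by (auto dest: DERIV_imp_deriv)
  then show ?thesis using deriv_theta_1_1_neq_0[OF 0] E0 by simp
qed

end

section \<open>The derivative of a third order theta function at the origin\<close>
lemma real_coordinates:
  assumes "Im \<tau> > 0"
  obtains s t where "z = of_real s + of_real t * \<tau>"
proof
  show "z = of_real (Re z - Im z / Im \<tau> * Re \<tau>) + of_real (Im z / Im \<tau>) * \<tau>"
    using assms by (simp add: complex_eq_iff)
qed

text \<open>
  In real coordinates with respect to \<open>1\<close> and \<open>\<tau>\<close> membership in the lattice is decided
  coordinatewise, which makes it easy to tell zeros of different theta functions apart.
\<close>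
lemma theta_eq_0_iff_coordinates:
  assumes \<tau>: "Im \<tau> > 0"
  shows "theta \<epsilon> \<epsilon>' (of_real s + of_real t * \<tau>) \<tau> = 0 \<longleftrightarrow>
     s + (\<epsilon>' - 1) / 2 \<in> \<int> \<and> t + (\<epsilon> - 1) / 2 \<in> \<int>"
proof -
  define a b where "a = s + (\<epsilon>' - 1) / 2" and "b = t + (\<epsilon> - 1) / 2"
  have "(of_real s + of_real t * \<tau>) + of_real (\<epsilon> - 1) / 2 * \<tau> + of_real (\<epsilon>' - 1) / 2 =
      of_real a + of_real b * \<tau>"
    by (simp add: a_def b_def algebra_simps add_divide_distrib diff_divide_distrib)
  moreover have "of_real a + of_real b * \<tau> = of_int m + of_int n * \<tau> \<longleftrightarrow> a = of_int m \<and> b = of_int n" for m n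
    using \<tau> by (auto simp: complex_eq_iff)
  ultimately have "theta \<epsilon> \<epsilon>' (of_real s + of_real t * \<tau>) \<tau> = 0 \<longleftrightarrow>
      (\<exists>m n::int. a = of_int m \<and> b = of_int n)"
    by (simp only: theta_eq_0_iff[OF \<tau>])
  then show ?thesis
    unfolding a_def b_def by (auto simp: Ints_def)
qed

lemma diff_half_notin_Ints: "x \<in> \<int> \<Longrightarrow> x - 1 / 2 \<notin> \<int>" for x :: real
proof
  assume "x \<in> \<int>" "x - 1 / 2 \<in> \<int>"
  then obtain a b :: int where "x = of_int a" "x - 1 / 2 = of_int b"
    by (auto elim!: Ints_cases)
  then have "real_of_int (2 * a - 1) = real_of_int (2 * b)" by simp
  then have "2 * a - 1 = 2 * b" by (simp only: of_int_eq_iff)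
  then show False by presburger
qed

text \<open>
  The entire functions with the multipliers of \<open>F\<close> form a space that is invariant under
  \<open>z \<mapsto> - z\<close>, and its odd elements are the multiples of \<open>S = \<theta>[1,1] \<theta>[0,0] \<theta>[0,1]\<close>. The odd part of \<open>F\<close> knows
  both \<open>F' 0\<close> and \<open>F (1/2)\<close>, because \<open>F (- 1/2) = - F (1/2)\<close>; their ratio is therefore the
  same as for \<open>S\<close>.
\<close>
lemma third_order_theta_deriv_at_0:
  assumes \<tau>: "Im \<tau> > 0" and F: "F holomorphic_on UNIV"
    and F1: "\<And>z. F (z + 1) = - F z"
    and F\<tau>: "\<And>z. F (z + \<tau>) = exp (- 3 * of_real pi * \<i> * (\<tau> + 2 * z)) * F z"
  shows "deriv F 0 * theta_const 1 0 \<tau> = - theta_deriv 1 1 \<tau> * F (1 / 2)"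
proof -
  define G where "G z = F z - F (- z)" for z
  define S where "S z = theta 1 1 z \<tau> * (theta 0 0 z \<tau> * theta 0 1 z \<tau>)" for z
  note hol = holomorphic_theta_UNIV[OF \<tau>]
  have G: "G holomorphic_on UNIV"
    unfolding G_def [abs_def]
    by (intro holomorphic_intros F holomorphic_on_compose_gen[OF _ F, unfolded o_def]) auto
  have S: "S holomorphic_on UNIV"
    unfolding S_def [abs_def] by (intro holomorphic_intros hol)
  have G1: "G (z + 1) = - G z" for z
    using F1[of "- z - 1"] by (simp add: G_def F1)
  have G\<tau>: "G (z + \<tau>) = exp (- 3 * of_real pi * \<i> * (\<tau> + 2 * z)) * G z" for z
  proof -
    define E where "E = exp (- 3 * of_real pi * \<i> * (\<tau> + 2 * z))"
    have "exp (- 3 * of_real pi * \<i> * (\<tau> + 2 * (- z - \<tau>))) = inverse E"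
      unfolding E_def exp_minus [symmetric] by (rule arg_cong[of _ _ exp]) (simp add: algebra_simps)
    then have "F (- z) = inverse E * F (- z - \<tau>)"
      using F\<tau>[of "- z - \<tau>"] by simp
    moreover have "E \<noteq> 0" by (simp add: E_def)
    ultimately have "F (- z - \<tau>) = E * F (- z)" by simp
    then show ?thesis by (simp add: G_def F\<tau> E_def right_diff_distrib)
  qed
  have S1: "S (z + 1) = - S z" for z
    by (simp add: S_def theta_add_1)
  have S\<tau>: "S (z + \<tau>) = exp (- 3 * of_real pi * \<i> * (\<tau> + 2 * z)) * S z" for z
  proof -
    define E where "E x = exp (- of_real pi * \<i> * (\<tau> + 2 * z + of_real x))" for x
    have "S (z + \<tau>) = E 1 * (E 0 * E 1) * S z"
      by (simp add: S_def E_def theta_add_\<tau> mult_ac)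
    also have "E 1 * (E 0 * E 1) =
        exp (- 3 * of_real pi * \<i> * (\<tau> + 2 * z)) * exp (2 * of_real pi * \<i> * of_int (- 1))"
      unfolding E_def exp_add [symmetric] by (rule arg_cong[of _ _ exp]) (simp add: algebra_simps)
    finally show ?thesis by (simp only: exp_2_pi_i_int mult_1_right)
  qed
  have G_lattice: "G (z + of_int m + of_int n * \<tau>) = 0" if "G z = 0" for z m n
  proof -
    have "(G (z + of_int m + of_int n * \<tau>) = 0) = (G z = 0)"
      by (rule lattice_invariant[where P = "\<lambda>z. G z = 0"]) (simp_all add: G1 G\<tau>)
    with that show ?thesis by simp
  qed
  have G_0: "G 0 = 0" by (simp add: G_def)
  \<comment> \<open>At a half period \<open>w\<close> the quasi-periods give \<open>F w = F (- w)\<close>; the half period \<open>1/2\<close> is the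
      exception.\<close>
  have G_half_\<tau>: "G (\<tau> / 2) = 0"
    using F\<tau>[of "- (\<tau> / 2)"] by (simp add: G_def)
  have G_half_1_\<tau>: "G (1 / 2 + \<tau> / 2) = 0"
  proof -
    define w where "w = - (1 / 2 + \<tau> / 2)"
    have "exp (- 3 * of_real pi * \<i> * (\<tau> + 2 * (w + 1))) =
        exp (2 * of_real pi * \<i> * of_int (- 2)) * exp (of_real pi * \<i>)"
      unfolding exp_add [symmetric] w_def by (rule arg_cong[of _ _ exp]) (simp add: algebra_simps)
    also have "\<dots> = - 1" by (simp only: exp_2_pi_i_int mult_1_left exp_pi_i)
    finally have "F (w + 1 + \<tau>) = F w" by (simp add: F\<tau> F1)
    moreover have "w + 1 + \<tau> = - w" by (simp add: w_def field_simps)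
    ultimately show ?thesis by (simp add: G_def w_def add.commute)
  qed
  \<comment> \<open>No two factors of \<open>S\<close> have a common zero, so its zeros are simple.\<close>
  have z11: "theta 1 1 (of_real s + of_real t * \<tau>) \<tau> = 0 \<longleftrightarrow> s \<in> \<int> \<and> t \<in> \<int>"
    and z00: "theta 0 0 (of_real s + of_real t * \<tau>) \<tau> = 0 \<longleftrightarrow> s - 1 / 2 \<in> \<int> \<and> t - 1 / 2 \<in> \<int>"
    and z01: "theta 0 1 (of_real s + of_real t * \<tau>) \<tau> = 0 \<longleftrightarrow> s \<in> \<int> \<and> t - 1 / 2 \<in> \<int>" for s t
    by (simp_all add: theta_eq_0_iff_coordinates[OF \<tau>])
  have S_zero: "G p = 0 \<and> deriv S p \<noteq> 0" if "S p = 0" for p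
  proof
    have simple: "deriv (\<lambda>z. theta \<epsilon> \<epsilon>' z \<tau>) p \<noteq> 0" if "theta \<epsilon> \<epsilon>' p \<tau> = 0" for \<epsilon> \<epsilon>' p
      using deriv_theta_neq_0[OF \<tau> that] .
    have 1: "deriv (\<lambda>z. theta 0 0 z \<tau> * theta 0 1 z \<tau>) p \<noteq> 0" if "theta 0 0 p \<tau> * theta 0 1 p \<tau> = 0" for p
    proof (rule simple_zeros_mult[OF hol hol _ _ that])
      fix p assume p: "theta 0 0 p \<tau> = 0"
      obtain s t where "p = of_real s + of_real t * \<tau>" by (rule real_coordinates[OF \<tau>])
      with p have "theta 0 1 p \<tau> \<noteq> 0"
        using diff_half_notin_Ints[of s] by (auto simp: z00 z01)
      with simple[OF p] show "deriv (\<lambda>z. theta 0 0 z \<tau>) p \<noteq> 0 \<and> theta 0 1 p \<tau> \<noteq> 0" ..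
    qed (rule simple)
    have 2: "theta 0 0 p \<tau> * theta 0 1 p \<tau> \<noteq> 0" if p: "theta 1 1 p \<tau> = 0" for p
    proof -
      obtain s t where "p = of_real s + of_real t * \<tau>" by (rule real_coordinates[OF \<tau>])
      with p show ?thesis using diff_half_notin_Ints[of t] by (auto simp: z00 z01 z11)
    qed
    show "deriv S p \<noteq> 0"
      unfolding S_def [abs_def]
    proof (rule simple_zeros_mult)
      show "(\<lambda>z. theta 0 0 z \<tau> * theta 0 1 z \<tau>) holomorphic_on UNIV"
        by (intro holomorphic_intros hol)
      show "theta 1 1 p \<tau> * (theta 0 0 p \<tau> * theta 0 1 p \<tau>) = 0"
        using that by (simp add: S_def)
    qed (use hol simple 1 2 in blast)+
    obtain s t where p: "p = of_real s + of_real t * \<tau>" by (rule real_coordinates[OF \<tau>])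
    from that consider "s \<in> \<int>" "t \<in> \<int>" | "s - 1 / 2 \<in> \<int>" "t - 1 / 2 \<in> \<int>" | "s \<in> \<int>" "t - 1 / 2 \<in> \<int>"
      unfolding S_def p by (auto simp: z00 z01 z11)
    then show "G p = 0"
    proof cases
      case 1
      then show ?thesis using G_lattice[OF G_0] by (auto simp: p elim!: Ints_cases)
    next
      case 2
      then obtain m n :: int where "s - 1 / 2 = of_int m" "t - 1 / 2 = of_int n" by (auto elim!: Ints_cases)
      then have "s = of_int m + 1 / 2" "t = of_int n + 1 / 2" by auto
      then show ?thesis using G_lattice[OF G_half_1_\<tau>, of m n] by (simp add: p algebra_simps)
    next
      case 3
      then obtain m n :: int where "s = of_int m" "t - 1 / 2 = of_int n" by (auto elim!: Ints_cases)
      then have "s = of_int m" "t = of_int n + 1 / 2" by auto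
      then show ?thesis using G_lattice[OF G_half_\<tau>, of m n] by (simp add: p algebra_simps)
    qed
  qed
  obtain z0 where "S z0 \<noteq> 0"
  proof (rule ccontr)
    assume "\<not> thesis"
    then have "S = (\<lambda>_. 0)" using that by blast
    with S_zero[of 0] show False by simp
  qed
  from proportional_if_same_multipliers[OF \<tau> G S this S_zero, of "\<lambda>_. - 1" "\<lambda>z. exp (- 3 * of_real pi * \<i> * (\<tau> + 2 * z))"]
  obtain c where c: "G z = c * S z" for z
    using G1 S1 G\<tau> S\<tau> by auto
  have "((\<lambda>z. F (- z)) has_field_derivative deriv F (- 0) * (- 1)) (at 0)"
    by (rule DERIV_chain2[OF holomorphic_derivI[OF F]]) (auto intro!: derivative_eq_intros)
  then have dG: "(G has_field_derivative (deriv F 0 - deriv F (- 0) * (- 1))) (at 0)"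
    unfolding G_def [abs_def] by (intro DERIV_diff holomorphic_derivI[OF F]) auto
  have "(S has_field_derivative
      (deriv (\<lambda>z. theta 1 1 z \<tau>) 0 * (theta 0 0 0 \<tau> * theta 0 1 0 \<tau>) +
       deriv (\<lambda>z. theta 0 0 z \<tau> * theta 0 1 z \<tau>) 0 * theta 1 1 0 \<tau>)) (at 0)"
    unfolding S_def [abs_def]
    by (intro DERIV_mult holomorphic_derivI[of _ UNIV] holomorphic_intros hol) auto
  moreover have "theta 1 1 0 \<tau> = 0" using theta_1_1_minus[of 0 \<tau>] by simp
  ultimately have "(S has_field_derivative theta_deriv 1 1 \<tau> * (theta 0 0 0 \<tau> * theta 0 1 0 \<tau>)) (at 0)"
    by (simp add: theta_deriv_def)
  then have "((\<lambda>z. c * S z) has_field_derivative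
      c * (theta_deriv 1 1 \<tau> * (theta 0 0 0 \<tau> * theta 0 1 0 \<tau>))) (at 0)"
    by (rule DERIV_cmult)
  moreover have "(\<lambda>z. c * S z) = G" using c by auto
  ultimately have "(G has_field_derivative
      c * (theta_deriv 1 1 \<tau> * (theta 0 0 0 \<tau> * theta 0 1 0 \<tau>))) (at 0)"
    by metis
  from DERIV_unique[OF dG this]
  have d: "2 * deriv F 0 = c * (theta_deriv 1 1 \<tau> * (theta 0 0 0 \<tau> * theta 0 1 0 \<tau>))"
    by simp
  \<comment> \<open>The shift by \<open>1/2\<close> adds \<open>1\<close> to the second characteristic, and \<open>[1, 2]\<close>, \<open>[0, 2]\<close> reduce to
      \<open>- [1, 0]\<close>, \<open>[0, 0]\<close>.\<close>
  have "G (1 / 2) = 2 * F (1 / 2)"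
    using F1[of "- (1 / 2)"] by (simp add: G_def)
  moreover have "S (1 / 2) = - theta 1 0 0 \<tau> * (theta 0 1 0 \<tau> * theta 0 0 0 \<tau>)"
    using theta_char_add_2[of 1 0 0 \<tau>] theta_char_add_2[of 0 0 0 \<tau>]
      theta_add_half[of 1 1 0 \<tau>] theta_add_half[of 0 0 0 \<tau>] theta_add_half[of 0 1 0 \<tau>]
    by (simp add: S_def)
  ultimately have h: "2 * F (1 / 2) = - c * theta 1 0 0 \<tau> * (theta 0 1 0 \<tau> * theta 0 0 0 \<tau>)"
    using c[of "1 / 2"] by (simp add: mult.assoc)
  have "2 * (deriv F 0 * theta 1 0 0 \<tau>) = (2 * deriv F 0) * theta 1 0 0 \<tau>"
    by (rule mult.assoc [symmetric])
  also have "\<dots> = - theta_deriv 1 1 \<tau> * (2 * F (1 / 2))"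
    unfolding d h by (simp only: mult_minus_left mult_minus_right minus_minus mult_ac)
  also have "\<dots> = 2 * (- theta_deriv 1 1 \<tau> * F (1 / 2))"
    by (rule mult.left_commute)
  finally show ?thesis
    unfolding theta_const_def by (subst (asm) mult_cancel_left) auto
qed

section \<open>Characteristics with first entry one third\<close>

text \<open>
  The hypothesis on \<open>\<epsilon>'\<close> removes the factor \<open>exp (- 3 \<pi> \<i> \<epsilon>')\<close> from the multiplier of the cube of
  \<open>\<theta>[1/3, \<epsilon>']\<close>, to which the preceding lemma is applied.
\<close>
lemma theta_deriv_char_one_third:
  assumes \<tau>: "Im \<tau> > 0" and \<epsilon>': "3 * \<epsilon>' = 2 * real_of_int k"
  shows "theta_deriv (1/3) \<epsilon>' \<tau> =
    - (1/3) * (theta_deriv 1 1 \<tau> * theta_const (1/3) (\<epsilon>' + 1) \<tau> ^ 3 /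
         (theta_const (1/3) \<epsilon>' \<tau> ^ 2 * theta_const 1 0 \<tau>))"
proof -
  define \<phi> where "\<phi> z = theta (1/3) \<epsilon>' z \<tau>" for z
  have \<phi>: "\<phi> holomorphic_on UNIV"
    unfolding \<phi>_def [abs_def] by (rule holomorphic_theta_UNIV[OF \<tau>])
  have "deriv (\<lambda>z. \<phi> z ^ 3) 0 * theta_const 1 0 \<tau> = - theta_deriv 1 1 \<tau> * \<phi> (1 / 2) ^ 3"
  proof (rule third_order_theta_deriv_at_0[OF \<tau>])
    show "(\<lambda>z. \<phi> z ^ 3) holomorphic_on UNIV" by (intro holomorphic_intros \<phi>)
    fix z
    have "exp (of_real pi * \<i> * of_real (1/3)) ^ 3 = (- 1 :: complex)"
      by (simp flip: exp_of_nat_mult)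
    then show "\<phi> (z + 1) ^ 3 = - (\<phi> z ^ 3)"
      unfolding \<phi>_def theta_add_1 power_mult_distrib by simp
    have "exp (- of_real pi * \<i> * (\<tau> + 2 * z + of_real \<epsilon>')) ^ 3 =
        exp (- 3 * of_real pi * \<i> * (\<tau> + 2 * z)) * exp (2 * of_real pi * \<i> * of_int (- k))"
    proof -
      have "3 * complex_of_real \<epsilon>' = 2 * of_int k"
        using arg_cong[OF \<epsilon>', of complex_of_real] by simp
      then have "3 * (\<tau> + 2 * z + of_real \<epsilon>') = 3 * (\<tau> + 2 * z) + 2 * of_int k" by simp
      then have "of_nat 3 * (- of_real pi * \<i> * (\<tau> + 2 * z + of_real \<epsilon>')) =
          - 3 * of_real pi * \<i> * (\<tau> + 2 * z) + 2 * of_real pi * \<i> * of_int (- k)"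
        by (simp add: algebra_simps)
      then show ?thesis unfolding exp_of_nat_mult [symmetric] exp_add [symmetric] by (rule arg_cong)
    qed
    then show "\<phi> (z + \<tau>) ^ 3 = exp (- 3 * of_real pi * \<i> * (\<tau> + 2 * z)) * \<phi> z ^ 3"
      unfolding \<phi>_def theta_add_\<tau> power_mult_distrib by (simp only: exp_2_pi_i_int mult_1_right)
  qed
  moreover have "((\<lambda>z. \<phi> z ^ 3) has_field_derivative of_nat 3 * (deriv \<phi> 0 * \<phi> 0 ^ (3 - Suc 0))) (at 0)"
    by (intro DERIV_power holomorphic_derivI[OF \<phi>]) auto
  then have "deriv (\<lambda>z. \<phi> z ^ 3) 0 = 3 * \<phi> 0 ^ 2 * deriv \<phi> 0"
    by (auto dest!: DERIV_imp_deriv)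
  moreover have "\<phi> (1 / 2) = theta_const (1/3) (\<epsilon>' + 1) \<tau>"
    using theta_add_half[of "1/3" \<epsilon>' 0 \<tau>] by (simp add: \<phi>_def theta_const_def)
  moreover have "deriv \<phi> 0 = theta_deriv (1/3) \<epsilon>' \<tau>" "\<phi> 0 = theta_const (1/3) \<epsilon>' \<tau>"
    by (simp_all add: \<phi>_def [abs_def] theta_deriv_def theta_const_def)
  ultimately have eq: "3 * theta_const (1/3) \<epsilon>' \<tau> ^ 2 * theta_deriv (1/3) \<epsilon>' \<tau> * theta_const 1 0 \<tau> =
      - theta_deriv 1 1 \<tau> * theta_const (1/3) (\<epsilon>' + 1) \<tau> ^ 3"
    by simp
  \<comment> \<open>In the zero criterion the first characteristic contributes \<open>(1/3 - 1)/2 = - 1/3\<close>.\<close>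
  have third: "- (1 / 3) \<notin> (\<int> :: real set)"
  proof
    assume "- (1 / 3) \<in> (\<int> :: real set)"
    then obtain a :: int where "- (1 / 3) = real_of_int a" by (elim Ints_cases)
    then have "real_of_int (3 * a) = real_of_int (- 1)" by simp
    then have "3 * a = - 1" by (simp only: of_int_eq_iff)
    then show False by presburger
  qed
  have "theta_const (1/3) \<epsilon>' \<tau> \<noteq> 0"
    using theta_eq_0_iff_coordinates[OF \<tau>, of "1/3" \<epsilon>' 0 0] third by (simp add: theta_const_def)
  moreover have "theta_const 1 0 \<tau> \<noteq> 0"
    using theta_eq_0_iff_coordinates[OF \<tau>, of 1 0 0 0] diff_half_notin_Ints[of 0] by (simp add: theta_const_def)
  ultimately have "theta_deriv (1/3) \<epsilon>' \<tau> =
      (3 * theta_const (1/3) \<epsilon>' \<tau> ^ 2 * theta_deriv (1/3) \<epsilon>' \<tau> * theta_const 1 0 \<tau>) /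
      (3 * (theta_const (1/3) \<epsilon>' \<tau> ^ 2 * theta_const 1 0 \<tau>))"
    by simp
  then show ?thesis unfolding eq by simp
qed

theorem theorem5p4:
  fixes \<tau> :: complex
  assumes "Im \<tau> > 0"
  shows "theta_deriv (1/3) 0 \<tau> =
           - (1/3) * (theta_deriv 1 1 \<tau> * theta_const (1/3) 1 \<tau> ^ 3 /
             (theta_const (1/3) 0 \<tau> ^ 2 * theta_const 1 0 \<tau>)) \<and>
         theta_deriv (1/3) (2/3) \<tau> =
           - (1/3) * (theta_deriv 1 1 \<tau> * theta_const (1/3) (5/3) \<tau> ^ 3 /
             (theta_const (1/3) (2/3) \<tau> ^ 2 * theta_const 1 0 \<tau>)) \<and>
         theta_deriv (1/3) (4/3) \<tau> =
           1/3 * (theta_deriv 1 1 \<tau> * theta_const (1/3) (1/3) \<tau> ^ 3 /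
             (theta_const (1/3) (4/3) \<tau> ^ 2 * theta_const 1 0 \<tau>))"
proof -
  \<comment> \<open>For \<open>\<epsilon>' = 4/3\<close> the cube on the right has the characteristic \<open>\<epsilon>' + 1 = 7/3 = 1/3 + 2\<close>.\<close>
  have "theta_const (1/3) (7/3) \<tau> = exp (of_real pi * \<i> * of_real (1/3)) * theta_const (1/3) (1/3) \<tau>"
    using theta_char_add_2[of "1/3" "1/3" 0 \<tau>] by (simp add: theta_const_def)
  moreover have "exp (of_real pi * \<i> * of_real (1/3)) ^ 3 = (- 1 :: complex)"
    by (simp flip: exp_of_nat_mult)
  ultimately have "theta_const (1/3) (7/3) \<tau> ^ 3 = - (theta_const (1/3) (1/3) \<tau> ^ 3)"
    by (simp only: power_mult_distrib) simp
  then show ?thesis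
    using theta_deriv_char_one_third[OF assms, of 0 0] theta_deriv_char_one_third[OF assms, of "2/3" 1]
      theta_deriv_char_one_third[OF assms, of "4/3" 2] by simp
qed

end
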